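(* The equation $\frac{1}{t_x} + \frac{1}{t_y} = \frac{2}{t_z}$ has infinitely many non-trivial solutions in positive integers $x, y, z$; that is, there are infinitely many non-constant three-term arithmetic progressions of the form $\frac{1}{t_x}, \frac{1}{t_z}, \frac{1}{t_y}$ with $x,y,z$ positive integers.
   Context: $t_n = \frac{n(n+1)}{2}$ denotes the $n$-th triangular number. A solution is non-trivial if it is not of the form $x=y=z$. *)

theory Defs
  imports Complex_Main "HOL-Library.Nat_Bijection"
begin

text \<open>The triangular number \<open>t\<^sub>n = n(n+1)/2\<close> is \<^const>\<open>triangle\<close>.\<close>

definition three_term_AP :: "rat \<Rightarrow> rat \<Rightarrow> rat \<Rightarrow> bool" where
  "three_term_AP a b c \<longleftrightarrow> b - a = c - b"

end

theory Submission
  imports Defs "HOL-Library.Infinite_Set"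
begin

text \<open>
  Look for solutions with \<open>y = t\<^sub>z\<close>. Since \<open>t\<^sub>y = y (y + 1) / 2\<close>, we have
  \<open>2 / t\<^sub>z - 1 / t\<^sub>y = 2 / y - 2 / (y (y + 1)) = 2 / (y + 1)\<close>, so the equation becomes
  \<open>2 t\<^sub>x = t\<^sub>z + 1\<close>. In terms of \<open>X = 2 x + 1\<close> and \<open>Z = 2 z + 1\<close> this is the Pell-type equation
  \<open>2 X\<^sup>2 - Z\<^sup>2 = 9\<close>, on whose solutions \<open>(X, Z) \<mapsto> (3 X + 2 Z, 4 X + 3 Z)\<close> acts.
  The orbit starts at \<open>(x, z) = (7, 10)\<close>, the image of the trivial solution \<open>x = z = 1\<close>.
\<close>

fun pell_pair :: "nat \<Rightarrow> nat \<times> nat" where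
  "pell_pair 0 = (7, 10)"
| "pell_pair (Suc n) = (case pell_pair n of (x, z) \<Rightarrow> (3 * x + 2 * z + 2, 4 * x + 3 * z + 3))"

lemma pell_pair_equation:
  assumes "pell_pair n = (x, z)"
  shows "2 * triangle x = triangle z + 1"
proof -
  have "2 * (x * (x + 1)) = z * (z + 1) + 2"
    using assms
  proof (induction n arbitrary: x z)
    case 0
    then show ?case by auto
  next
    case (Suc n)
    obtain u w where uw: "pell_pair n = (u, w)" by force
    have "2 * (u * (u + 1)) = w * (w + 1) + 2" using Suc.IH[OF uw] .
    \<comment> \<open>The constants 2 and 3 come from rewriting the action on \<open>(X, Z)\<close>
      in terms of \<open>(X - 1) / 2\<close> and \<open>(Z - 1) / 2\<close>. The action preserves
      \<open>2 X^2 - Z^2\<close>, so expanding the goal leaves exactly the induction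
      hypothesis.\<close>
    moreover have "x = 3 * u + 2 * w + 2" "z = 4 * u + 3 * w + 3"
      using Suc.prems uw by auto
    ultimately show ?case by (simp add: algebra_simps)
  qed
  moreover have "2 * triangle k = k * (k + 1)" for k
    by (simp add: triangle_def)
  ultimately show ?thesis
    by (metis (no_types, lifting) add_mult_distrib2 mult.right_neutral mult_cancel_left zero_neq_numeral)
qed

lemma strict_mono_snd_pell_pair: "strict_mono (\<lambda>n. snd (pell_pair n))"
  by (auto simp: strict_mono_Suc_iff split: prod.split)

lemma snd_pell_pair_gt_1: "1 < snd (pell_pair n)"
  by (induction n) (auto split: prod.split)

lemma strict_mono_triangle: "strict_mono triangle"
  by (simp add: strict_mono_Suc_iff)

lemma reciprocal_triangle_equation:
  assumes "2 * triangle x = triangle z + 1" "0 < z"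
  shows "1 / (of_nat (triangle x) :: rat) + 1 / of_nat (triangle (triangle z)) = 2 / of_nat (triangle z)"
proof -
  define y where "y = triangle z"
  have "0 < y"
    using strict_monoD[OF strict_mono_triangle assms(2)] by (simp add: y_def)
  have "2 * (of_nat (triangle x) :: rat) = of_nat y + 1"
    using arg_cong[OF assms(1), of "of_nat :: nat \<Rightarrow> rat"] by (simp add: y_def)
  then have x: "(of_nat (triangle x) :: rat) = (of_nat y + 1) / 2"
    by simp
  have "2 * triangle y = y * (y + 1)"
    by (simp add: triangle_def)
  from arg_cong[OF this, of "of_nat :: nat \<Rightarrow> rat"]
  have y: "(of_nat (triangle y) :: rat) = of_nat y * (of_nat y + 1) / 2"
    by (simp add: field_simps)
  \<comment> \<open>With \<open>0 < y\<close>, this makes every denominator nonzero, so the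
    fractions can be cleared.\<close>
  have "1 + (of_nat y :: rat) \<noteq> 0"
    by (metis of_nat_Suc of_nat_neq_0)
  then show ?thesis
    using \<open>0 < y\<close> unfolding y_def[symmetric] x y
    by (simp add: divide_simps)
qed

text \<open>Transfers distinctness of indices to the terms of the progressions. Index 0 is no
  exception: its value is \<open>1 / 0 = 0\<close>, while all others are positive.\<close>

lemma inj_reciprocal_triangle: "inj (\<lambda>n. 1 / (of_nat (triangle n) :: rat))"
  using strict_mono_imp_inj_on[OF strict_mono_triangle] by (auto simp: inj_on_def)

theorem theorem4p1:
  shows "infinite {(x::nat, y::nat, z::nat).
           x > 0 \<and> y > 0 \<and> z > 0 \<and>
           1 / (of_nat (triangle x) :: rat) + 1 / of_nat (triangle y) = 2 / of_nat (triangle z) \<and>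
           \<not> (x = y \<and> y = z)}
       \<and> infinite {(a::rat, b::rat, c::rat).
           three_term_AP a b c \<and> \<not> (a = b \<and> b = c) \<and>
           (\<exists>x y z :: nat. x > 0 \<and> y > 0 \<and> z > 0 \<and>
              a = 1 / of_nat (triangle x) \<and>
              b = 1 / of_nat (triangle z) \<and>
              c = 1 / of_nat (triangle y))}"
    (is "infinite ?S \<and> infinite ?P")
proof -
  define x z where "x n = fst (pell_pair n)" and "z n = snd (pell_pair n)" for n
  define y where "y n = triangle (z n)" for n
  define r :: "nat \<Rightarrow> rat" where "r = (\<lambda>n. 1 / of_nat (triangle n))"
  have inj_z: "inj z"
    unfolding z_def using strict_mono_snd_pell_pair by (rule strict_mono_imp_inj_on)
  have inj_r: "inj r"
    unfolding r_def by (rule inj_reciprocal_triangle)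
  have z_gt: "1 < z n" for n
    unfolding z_def by (rule snd_pell_pair_gt_1)
  have pell: "2 * triangle (x n) = triangle (z n) + 1" for n
    by (rule pell_pair_equation) (simp add: x_def z_def)
  \<comment> \<open>For \<open>x n = 0\<close> the left side of \<open>pell\<close> would vanish,
    but the right side is at least 1.\<close>
  have x_pos: "0 < x n" for n
    using pell[of n] by (cases "x n") auto
  \<comment> \<open>Non-triviality rests on this. It needs \<open>z n\<close> to be at least 2,
    since \<open>triangle 1 = 1\<close>; two unfoldings of \<open>triangle\<close> then leave the
    positive surplus \<open>triangle k + k + 1\<close>.\<close>
  have y_gt: "z n < y n" for n
  proof -
    obtain k where "z n = Suc (Suc k)"
      using z_gt[of n] by (metis One_nat_def less_iff_Suc_add add_Suc)
    then show ?thesis by (simp add: y_def)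
  qed
  have eq: "r (x n) + r (y n) = 2 / of_nat (triangle (z n))" for n
    unfolding r_def y_def
    by (rule reciprocal_triangle_equation[OF pell]) (use z_gt[of n] in simp)
  have "range (\<lambda>n. (x n, y n, z n)) \<subseteq> ?S"
    using x_pos y_gt z_gt eq unfolding r_def
    by (auto simp: less_imp_neq[symmetric] intro: less_trans[OF _ y_gt] less_trans[OF zero_less_one z_gt])
  moreover have "inj (\<lambda>n. (x n, y n, z n))"
    using inj_z by (auto simp: inj_on_def)
  ultimately have "infinite ?S"
    using infinite_super range_inj_infinite by blast
  moreover have "range (\<lambda>n. (r (x n), r (z n), r (y n))) \<subseteq> ?P"
  proof clarify
    fix n
    have "r (z n) \<noteq> r (y n)"
      using y_gt[of n] inj_r by (auto dest: injD)
    moreover have "three_term_AP (r (x n)) (r (z n)) (r (y n))"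
      using eq[of n] by (simp add: three_term_AP_def r_def)
    moreover have "0 < y n" "0 < z n"
      using y_gt[of n] z_gt[of n] by simp_all
    ultimately show "three_term_AP (r (x n)) (r (z n)) (r (y n)) \<and>
        \<not> (r (x n) = r (z n) \<and> r (z n) = r (y n)) \<and>
        (\<exists>x' y' z' :: nat. x' > 0 \<and> y' > 0 \<and> z' > 0 \<and>
           r (x n) = 1 / of_nat (triangle x') \<and> r (z n) = 1 / of_nat (triangle z') \<and>
           r (y n) = 1 / of_nat (triangle y'))"
      using x_pos[of n] unfolding r_def by blast
  qed
  \<comment> \<open>The middle term alone already determines \<open>n\<close>.\<close>
  moreover have "inj (\<lambda>n. (r (x n), r (z n), r (y n)))"
    using inj_z inj_r by (auto simp: inj_on_def)
  ultimately show ?thesis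
    using infinite_super range_inj_infinite by blast
qed

end
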